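(* Let $a\in\mathbb{Z}_{\ge1}^n$, $b\in\mathbb{Z}^n$, and $w\in\mathbb{Z}_{\ge0}^n$ with $\sum_{i\le n}w_i/a_i\le1$. Suppose there is an algorithm which, for any task parameters $(c_i,p_i,J_i)_{i\in I}$ and any integer $\gamma$, computes $\min\{t\in\mathbb{Z}_{\ge0}: t\ge\gamma+\sum_{i\in I}c_i\lceil (t+J_i)/p_i\rceil\}$ in time at most $T_{\mathcal{R}}$. Then \[ \min\Big\{s+\sum_{i\le n}w_ix_i : s+a_ix_i\ge b_i\ \forall i\le n,\ s\in\mathbb{Z}_{\ge0},\ x\in\mathbb{Z}^n\Big\} \] can be computed in time $O(n+T_{\mathcal{R}}\log b_{\max})$, where $b_{\max}=\max_ib_i$.
   Context: Running times count arithmetic operations on numbers from the input. *)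

theory Defs
  imports Complex_Main
begin

definition is_min :: "int \<Rightarrow> int set \<Rightarrow> bool" where
  "is_min v S \<longleftrightarrow> v \<in> S \<and> (\<forall>u\<in>S. v \<le> u)"

text \<open>A task is a triple \<open>(c, p, J)\<close> of execution time, period and release jitter; a finite
  family of tasks is given as a list.\<close>

type_synonym task = "int \<times> int \<times> int"

definition valid_task :: "task \<Rightarrow> bool" where
  "valid_task = (\<lambda>(c, p, J). 0 \<le> c \<and> 1 \<le> p \<and> 0 \<le> J)"

definition response_times :: "task list \<Rightarrow> int \<Rightarrow> int set" where
  "response_times ts \<gamma> =
     {t. 0 \<le> t \<and> t \<ge> \<gamma> + (\<Sum>(c, p, J)\<leftarrow>ts. c * \<lceil>real_of_int (t + J) / real_of_int p\<rceil>)}"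

definition mixing_values ::
    "nat \<Rightarrow> (nat \<Rightarrow> int) \<Rightarrow> (nat \<Rightarrow> int) \<Rightarrow> (nat \<Rightarrow> int) \<Rightarrow> int set" where
  "mixing_values n a b w =
     {s + (\<Sum>i<n. w i * x i) | s x. 0 \<le> s \<and> (\<forall>i<n. s + a i * x i \<ge> b i)}"

text \<open>The subroutine is a black box: \<open>answer R ts \<gamma>\<close> is what it returns on the tasks \<open>ts\<close> and
  \<open>\<gamma>\<close>, and \<open>cost R ts \<gamma>\<close> is the number of operations of that run.\<close>

record subroutine =
  answer :: "task list \<Rightarrow> int \<Rightarrow> int"
  cost :: "task list \<Rightarrow> int \<Rightarrow> nat"

text \<open>If \<open>response_times ts \<gamma>\<close> is empty (possible once the utilisation \<open>\<Sum>c/p\<close> reaches 1), there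
  is no minimum and nothing is assumed about the answer. Every run takes at least one operation.\<close>

definition response_time_algorithm :: "subroutine \<Rightarrow> real \<Rightarrow> bool" where
  "response_time_algorithm R T \<longleftrightarrow>
     (\<forall>ts \<gamma>. (\<forall>\<tau>\<in>set ts. valid_task \<tau>) \<longrightarrow>
        (response_times ts \<gamma> \<noteq> {} \<longrightarrow> is_min (answer R ts \<gamma>) (response_times ts \<gamma>)) \<and>
        1 \<le> cost R ts \<gamma> \<and> real (cost R ts \<gamma>) \<le> T)"

text \<open>Algorithms are programs of a while-language over integer variables and integer arrays
  with unit-cost arithmetic. \<open>Div\<close> is floor division. \<open>Call x c p J k g\<close> runs the subroutine on
  the tasks stored in the first \<open>k\<close> entries of the arrays \<open>c\<close>, \<open>p\<close>, \<open>J\<close> and stores its answer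
  in \<open>x\<close>; the arrays are passed by reference, so writing them is charged to the caller.\<close>

datatype aexp =
    Const int
  | Var string
  | Elem string aexp
  | Plus aexp aexp
  | Minus aexp aexp
  | Times aexp aexp
  | Div aexp aexp

datatype bexp =
    Less aexp aexp
  | Not bexp
  | And bexp bexp

datatype com =
    Skip
  | Assign string aexp
  | Store string aexp aexp
  | Seq com com
  | If bexp com com
  | While bexp com
  | Call string string string string aexp aexp

record state =
  var :: "string \<Rightarrow> int"
  arr :: "string \<Rightarrow> int \<Rightarrow> int"

fun aval :: "aexp \<Rightarrow> state \<Rightarrow> int" where
  "aval (Const k) \<sigma> = k"
| "aval (Var x) \<sigma> = var \<sigma> x"
| "aval (Elem v e) \<sigma> = arr \<sigma> v (aval e \<sigma>)"
| "aval (Plus e f) \<sigma> = aval e \<sigma> + aval f \<sigma>"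
| "aval (Minus e f) \<sigma> = aval e \<sigma> - aval f \<sigma>"
| "aval (Times e f) \<sigma> = aval e \<sigma> * aval f \<sigma>"
| "aval (Div e f) \<sigma> = aval e \<sigma> div aval f \<sigma>"

fun bval :: "bexp \<Rightarrow> state \<Rightarrow> bool" where
  "bval (Less e f) \<sigma> \<longleftrightarrow> aval e \<sigma> < aval f \<sigma>"
| "bval (Not b) \<sigma> \<longleftrightarrow> \<not> bval b \<sigma>"
| "bval (And b d) \<sigma> \<longleftrightarrow> bval b \<sigma> \<and> bval d \<sigma>"

fun acost :: "aexp \<Rightarrow> nat" where
  "acost (Const k) = 1"
| "acost (Var x) = 1"
| "acost (Elem v e) = acost e + 1"
| "acost (Plus e f) = acost e + acost f + 1"
| "acost (Minus e f) = acost e + acost f + 1"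
| "acost (Times e f) = acost e + acost f + 1"
| "acost (Div e f) = acost e + acost f + 1"

fun bcost :: "bexp \<Rightarrow> nat" where
  "bcost (Less e f) = acost e + acost f + 1"
| "bcost (Not b) = bcost b + 1"
| "bcost (And b d) = bcost b + bcost d + 1"

definition stored_tasks :: "state \<Rightarrow> string \<Rightarrow> string \<Rightarrow> string \<Rightarrow> int \<Rightarrow> task list" where
  "stored_tasks \<sigma> c p J k = map (\<lambda>i. (arr \<sigma> c i, arr \<sigma> p i, arr \<sigma> J i)) [0..k - 1]"

text \<open>\<open>exec R P \<sigma> m \<sigma>'\<close>: started in \<open>\<sigma>\<close>, the program \<open>P\<close> with subroutine \<open>R\<close> terminates in \<open>\<sigma>'\<close>
  after \<open>m\<close> operations, those of the subroutine included.\<close>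

inductive exec :: "subroutine \<Rightarrow> com \<Rightarrow> state \<Rightarrow> nat \<Rightarrow> state \<Rightarrow> bool" for R where
  Skip: "exec R Skip \<sigma> 1 \<sigma>"
| Assign: "exec R (Assign x e) \<sigma> (acost e + 1) (\<sigma>\<lparr>var := (var \<sigma>)(x := aval e \<sigma>)\<rparr>)"
| Store: "exec R (Store v e f) \<sigma> (acost e + acost f + 1)
    (\<sigma>\<lparr>arr := (arr \<sigma>)(v := (arr \<sigma> v)(aval e \<sigma> := aval f \<sigma>))\<rparr>)"
| Seq: "\<lbrakk>exec R P \<sigma> m \<sigma>'; exec R Q \<sigma>' k \<sigma>''\<rbrakk> \<Longrightarrow> exec R (Seq P Q) \<sigma> (m + k) \<sigma>''"
| IfTrue: "\<lbrakk>bval b \<sigma>; exec R P \<sigma> m \<sigma>'\<rbrakk> \<Longrightarrow> exec R (If b P Q) \<sigma> (bcost b + m) \<sigma>'"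
| IfFalse: "\<lbrakk>\<not> bval b \<sigma>; exec R Q \<sigma> m \<sigma>'\<rbrakk> \<Longrightarrow> exec R (If b P Q) \<sigma> (bcost b + m) \<sigma>'"
| WhileFalse: "\<not> bval b \<sigma> \<Longrightarrow> exec R (While b P) \<sigma> (bcost b) \<sigma>"
| WhileTrue: "\<lbrakk>bval b \<sigma>; exec R P \<sigma> m \<sigma>'; exec R (While b P) \<sigma>' k \<sigma>''\<rbrakk>
    \<Longrightarrow> exec R (While b P) \<sigma> (bcost b + m + k) \<sigma>''"
| Call: "\<lbrakk>ts = stored_tasks \<sigma> c p J (aval k \<sigma>); \<gamma> = aval g \<sigma>\<rbrakk>
    \<Longrightarrow> exec R (Call x c p J k g) \<sigma> (acost k + acost g + 1 + cost R ts \<gamma>)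
          (\<sigma>\<lparr>var := (var \<sigma>)(x := answer R ts \<gamma>)\<rparr>)"

inductive_cases SkipE: "exec R Skip \<sigma> m \<sigma>'"
inductive_cases AssignE: "exec R (Assign x e) \<sigma> m \<sigma>'"
inductive_cases StoreE: "exec R (Store v e f) \<sigma> m \<sigma>'"
inductive_cases SeqE: "exec R (Seq P Q) \<sigma> m \<sigma>'"
inductive_cases IfE: "exec R (If b P Q) \<sigma> m \<sigma>'"
inductive_cases WhileE: "exec R (While b P) \<sigma> m \<sigma>'"
inductive_cases CallE: "exec R (Call x c p J k g) \<sigma> m \<sigma>'"

lemma exec_deterministic:
  "\<lbrakk>exec R P \<sigma> m \<sigma>'; exec R P \<sigma> k \<sigma>''\<rbrakk> \<Longrightarrow> k = m \<and> \<sigma>'' = \<sigma>'"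
proof (induction arbitrary: k \<sigma>'' rule: exec.induct)
  case Skip
  then show ?case by (auto elim: SkipE)
next
  case Assign
  then show ?case by (auto elim: AssignE)
next
  case Store
  then show ?case by (auto elim: StoreE)
next
  case Seq
  from Seq.prems show ?case by (rule SeqE) (use Seq.IH in blast)
next
  case IfTrue
  from IfTrue.prems show ?case by (rule IfE) (use IfTrue.IH IfTrue.hyps in blast)+
next
  case IfFalse
  from IfFalse.prems show ?case by (rule IfE) (use IfFalse.IH IfFalse.hyps in blast)+
next
  case WhileFalse
  from WhileFalse.prems show ?case by (rule WhileE) (use WhileFalse.hyps in blast)+
next
  case WhileTrue
  from WhileTrue.prems show ?case by (rule WhileE) (use WhileTrue.IH WhileTrue.hyps in blast)+
next
  case Call
  then show ?case by (auto elim: CallE)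
qed

definition input_state ::
    "nat \<Rightarrow> (nat \<Rightarrow> int) \<Rightarrow> (nat \<Rightarrow> int) \<Rightarrow> (nat \<Rightarrow> int) \<Rightarrow> state" where
  "input_state n a b w =
     (let vec = (\<lambda>v i. if 0 \<le> i \<and> i < int n then v (nat i) else 0)
      in \<lparr>var = (\<lambda>x. 0)(''n'' := int n),
          arr = (\<lambda>x i. 0)(''a'' := vec a, ''b'' := vec b, ''w'' := vec w)\<rparr>)"

definition computes_mixing_min_within ::
    "com \<Rightarrow> subroutine \<Rightarrow> nat \<Rightarrow> (nat \<Rightarrow> int) \<Rightarrow> (nat \<Rightarrow> int) \<Rightarrow> (nat \<Rightarrow> int) \<Rightarrow> real \<Rightarrow> bool" where
  "computes_mixing_min_within P R n a b w B \<longleftrightarrow>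
     (\<exists>m \<sigma>. exec R P (input_state n a b w) m \<sigma> \<and>
        is_min (var \<sigma> ''opt'') (mixing_values n a b w) \<and> real m \<le> B)"

definition bmax :: "nat \<Rightarrow> (nat \<Rightarrow> int) \<Rightarrow> int" where
  "bmax n b = Max (b ` {..<n})"

end

theory Submission
  imports Defs
begin

text \<open>One call of the subroutine suffices. Let \<open>f s = s + (\<Sum>i<n. w i * \<lceil>(b i - s) / a i\<rceil>)\<close> be the
  best value for a given \<open>s\<close>, and \<open>M = (\<Prod>i<n. a i)\<close>. Then \<open>f (s + M) = f s + E\<close> with \<open>E \<ge> 0\<close>, so
  the minimum over \<open>s \<ge> 0\<close> is attained below \<open>M\<close> (but possibly far above \<open>Max (b ` {..<n})\<close>). Time plays the
  role of \<open>-s\<close>. Scaling the periods \<open>a i\<close> by \<open>M + 1\<close> and the costs \<open>w i\<close> only by \<open>M\<close>, and adding a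
  task of period \<open>(M + 1) * M\<close> and cost \<open>M * E\<close>, makes the slack of the response time inequality
  grow by exactly \<open>M\<close> from one block of length \<open>(M + 1) * M\<close> to the next. Hence the index of the
  first block with a solution is, up to an additive constant, the minimum of \<open>f\<close>. Since arithmetic
  has unit cost, the size of \<open>M\<close> does not matter.\<close>

section \<open>Ceiling division of integers\<close>

definition cdiv :: "int \<Rightarrow> int \<Rightarrow> int" where
  "cdiv x y = - ((- x) div y)"

lemma ceiling_divide_eq_cdiv: "\<lceil>real_of_int x / real_of_int y\<rceil> = cdiv x y"
  by (simp add: ceiling_divide_eq_div cdiv_def)

lemma cdiv_ge:
  assumes "0 < y"
  shows "x \<le> y * cdiv x y"
  using mult_div_mod_eq[of y "- x"] pos_mod_sign[OF assms, of "- x"]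
  unfolding cdiv_def mult_minus_right by linarith

lemma cdiv_le: "0 < y \<Longrightarrow> x \<le> y * z \<Longrightarrow> cdiv x y \<le> z"
  using zdiv_mono1[of "y * (- z)" "- x" y] nonzero_mult_div_cancel_left[of y "- z"]
  by (simp add: cdiv_def)

lemma cdiv_add: "0 < y \<Longrightarrow> cdiv (x + z * y) y = cdiv x y + z"
  using div_mult_self1[of y "- x" "- z"] by (simp add: cdiv_def)

text \<open>Rounding up can be done in two stages, and a shift by a multiple of \<open>N\<close>
  passes through the first stage exactly. With \<open>N = M + 1\<close>, every task sees
  \<open>t\<close> only through \<open>cdiv t (M + 1)\<close>.\<close>

lemma cdiv_scaled:
  assumes "0 < N" "0 \<le> y"
  shows "cdiv (t + N * j) (N * y) = cdiv (cdiv t N + j) y"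
proof -
  have "(- t - N * j) div N = - t div N - j"
    using div_mult_self2[of N "- t" "- j"] assms by simp
  then show ?thesis
    using zdiv_zmult2_eq[of y "- t - N * j" N] assms by (simp add: cdiv_def)
qed

text \<open>The remainder of \<open>x - 1\<close> is \<open>y - 1 - (- x) mod y\<close>, which lies
  between 0 and \<open>y - 1\<close>. This leads from a time rounded up to the number of its
  block.\<close>

lemma cdiv_minus_one:
  assumes "0 < y"
  shows "cdiv x y - 1 = (x - 1) div y"
proof -
  have "x - 1 = y * (cdiv x y - 1) + (y - 1 - (- x) mod y)"
    using mult_div_mod_eq[of y "- x"]
    unfolding cdiv_def mult_minus_right right_diff_distrib mult_1_right by linarith
  then have "(x - 1) div y = cdiv x y - 1"
    by (rule int_div_pos_eq)
      (use pos_mod_sign[OF assms, of "- x"] pos_mod_bound[OF assms, of "- x"] in linarith)+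
  then show ?thesis by simp
qed

section \<open>The best value as a function of \<open>s\<close>\<close>

locale mixing_set =
  fixes n :: nat and a b w :: "nat \<Rightarrow> int"
  assumes a_ge_1: "\<And>i. i < n \<Longrightarrow> 1 \<le> a i"
    and w_nonneg: "\<And>i. i < n \<Longrightarrow> 0 \<le> w i"
    and utilisation: "(\<Sum>i<n. real_of_int (w i) / real_of_int (a i)) \<le> 1"
begin

definition M :: int where "M = (\<Prod>i<n. a i)"

text \<open>\<open>M\<close> times one minus the utilisation; the divisions are exact.\<close>

definition E :: int where "E = M - (\<Sum>i<n. w i * (M div a i))"

definition W :: int where "W = (\<Sum>i<n. w i * (b i div a i))"

text \<open>Jitters must be nonnegative while \<open>b i\<close> may be negative, so only the
  remainder of \<open>b i\<close> modulo \<open>a i\<close> enters; the quotients are collected in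
  \<open>W\<close>.\<close>

definition tasks :: "task list" where
  "tasks = map (\<lambda>i. (M * w i, (M + 1) * a i, (M + 1) * (b i mod a i))) [0..<n]
     @ [(M * E, (M + 1) * M, 0)]"

definition best_value :: "int \<Rightarrow> int" where
  "best_value s = s + (\<Sum>i<n. w i * cdiv (b i - s) (a i))"

lemma M_pos: "0 < M"
  unfolding M_def by (rule prod_pos) (use a_ge_1 in force)

lemma M_div: "i < n \<Longrightarrow> M = (M div a i) * a i"
  by (simp add: M_def dvd_prodI)

lemma E_nonneg: "0 \<le> E"
proof -
  have "real_of_int (\<Sum>i<n. w i * (M div a i)) =
      real_of_int M * (\<Sum>i<n. real_of_int (w i) / real_of_int (a i))"
    unfolding of_int_sum sum_distrib_left
  proof (rule sum.cong)
    fix i assume "i \<in> {..<n}"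
    then have "i < n" by simp
    then have "real_of_int M = real_of_int (M div a i) * real_of_int (a i)"
      using M_div by (metis of_int_mult)
    moreover have "a i \<noteq> 0" using a_ge_1[OF \<open>i < n\<close>] by simp
    ultimately show "real_of_int (w i * (M div a i)) = M * (real_of_int (w i) / real_of_int (a i))"
      by simp
  qed simp
  also have "\<dots> \<le> real_of_int M"
    using utilisation M_pos by (simp add: mult_left_le)
  finally show ?thesis by (simp only: E_def of_int_le_iff)
qed

lemma best_value_in_mixing_values: "0 \<le> s \<Longrightarrow> best_value s \<in> mixing_values n a b w"
proof -
  assume "0 \<le> s"
  moreover have "\<forall>i<n. b i \<le> s + a i * cdiv (b i - s) (a i)"
    using cdiv_ge a_ge_1 by (smt (verit))
  ultimately show ?thesis
    unfolding mixing_values_def best_value_def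
    by (intro CollectI exI[of _ s] exI[of _ "\<lambda>i. cdiv (b i - s) (a i)"]) auto
qed

text \<open>For fixed \<open>s\<close>, feasibility forces each \<open>x i\<close> up to the ceiling
  in \<open>best_value\<close>, and nonnegative weights make these ceilings the cheapest
  choice.\<close>

lemma mixing_value_ge_best_value:
  assumes "v \<in> mixing_values n a b w"
  obtains s where "0 \<le> s" "best_value s \<le> v"
proof -
  obtain s x where v: "v = s + (\<Sum>i<n. w i * x i)" and s: "0 \<le> s"
    and x: "\<forall>i<n. b i \<le> s + a i * x i"
    using assms unfolding mixing_values_def by blast
  have "cdiv (b i - s) (a i) \<le> x i" if "i < n" for i
    by (rule cdiv_le) (use a_ge_1[OF that] x that in force)+
  then have "best_value s \<le> v"
    unfolding best_value_def v by (intro add_left_mono sum_mono mult_left_mono) (auto simp: w_nonneg)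
  with s that show ?thesis by blast
qed

text \<open>Each \<open>a i\<close> divides \<open>M\<close>, so every ceiling moves by an exact
  integer. Negative \<open>k\<close> and \<open>s\<close> are covered, as time stands for
  \<open>- s\<close>.\<close>

lemma best_value_shift: "best_value (s + k * M) = best_value s + k * E"
proof -
  have "cdiv (b i - (s + k * M)) (a i) = cdiv (b i - s) (a i) - k * (M div a i)" if "i < n" for i
  proof -
    have "b i - (s + k * M) = b i - s + (- (k * (M div a i))) * a i"
      using M_div[OF that] by (simp add: algebra_simps)
    then have "cdiv (b i - (s + k * M)) (a i) = cdiv (b i - s) (a i) + - (k * (M div a i))"
      using cdiv_add[of "a i" "b i - s" "- (k * (M div a i))"] a_ge_1[OF that] by (simp only:)
    then show ?thesis by simp
  qed
  then have "(\<Sum>i<n. w i * cdiv (b i - (s + k * M)) (a i))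
      = (\<Sum>i<n. w i * cdiv (b i - s) (a i) - k * (w i * (M div a i)))"
    by (intro sum.cong refl)
      (simp only: lessThan_iff right_diff_distrib mult.left_commute)
  then show ?thesis
    by (simp add: best_value_def E_def sum_subtractf sum_distrib_left algebra_simps)
qed

text \<open>Each ceiling is at least \<open>b i div a i - s / a i\<close>, and the losses, weighted
  by \<open>w i\<close>, add up to at most \<open>s\<close> by the utilisation bound. The proof
  multiplies by \<open>M\<close> to stay in the integers. The bound makes block numbers nonnegative
  when a solution is encoded.\<close>

lemma best_value_ge_W:
  assumes "0 \<le> s"
  shows "W \<le> best_value s"
proof -
  have "M * (b i div a i) - (M div a i) * s \<le> M * cdiv (b i - s) (a i)" if "i < n" for i
  proof -
    have a: "0 < a i" using a_ge_1[OF that] by simp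
    have "a i * (b i div a i) \<le> b i"
      using mult_div_mod_eq[of "a i" "b i"] pos_mod_sign[OF a, of "b i"] by linarith
    then have "a i * (b i div a i) - s \<le> a i * cdiv (b i - s) (a i)"
      using cdiv_ge[OF a, of "b i - s"] by linarith
    then have "(M div a i) * (a i * (b i div a i) - s) \<le> (M div a i) * (a i * cdiv (b i - s) (a i))"
      using a M_pos by (intro mult_left_mono) (simp_all add: pos_imp_zdiv_nonneg_iff)
    then show ?thesis
      using M_div[OF that] by (simp add: right_diff_distrib flip: mult.assoc)
  qed
  then have "(\<Sum>i<n. w i * (M * (b i div a i) - (M div a i) * s))
      \<le> (\<Sum>i<n. w i * (M * cdiv (b i - s) (a i)))"
    by (intro sum_mono mult_left_mono) (auto simp: w_nonneg)
  moreover have "(\<Sum>i<n. w i * (M * (b i div a i) - (M div a i) * s)) = M * W - (M - E) * s"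
    by (simp add: W_def E_def sum_subtractf sum_distrib_left sum_distrib_right algebra_simps)
  moreover have "(\<Sum>i<n. w i * (M * cdiv (b i - s) (a i))) = M * (best_value s - s)"
    by (simp add: best_value_def sum_distrib_left algebra_simps)
  ultimately have "M * W + E * s \<le> M * best_value s"
    by (simp add: algebra_simps)
  then have "M * W \<le> M * best_value s"
    using E_nonneg assms mult_nonneg_nonneg[of E s] by linarith
  then show ?thesis using M_pos by simp
qed

section \<open>Solutions encoded as response times\<close>

lemma valid_tasks: "\<forall>\<tau>\<in>set tasks. valid_task \<tau>"
proof -
  have "valid_task (M * w i, (M + 1) * a i, (M + 1) * (b i mod a i))" if "i < n" for i
    using M_pos w_nonneg[OF that] a_ge_1[OF that] mult_mono[of 1 "M + 1" 1 "a i"]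
    by (simp add: valid_task_def)
  moreover have "valid_task (M * E, (M + 1) * M, 0)"
    using M_pos E_nonneg mult_mono[of 1 "M + 1" 1 M] by (simp add: valid_task_def)
  ultimately show ?thesis by (auto simp: tasks_def)
qed

text \<open>A time \<open>t\<close> encodes a pair: \<open>u = \<lceil>t / (M + 1)\<rceil>\<close> fixes \<open>s\<close> modulo \<open>M\<close>, and the quotient of
  \<open>u - 1\<close> by \<open>M\<close> is the value that \<open>s\<close> has to reach, up to the offset \<open>W\<close>.\<close>

lemma response_times_tasks_iff:
  "t \<in> response_times tasks 1 \<longleftrightarrow>
     0 \<le> t \<and> 1 + M * (best_value ((- cdiv t (M + 1)) mod M) + cdiv t (M + 1) - W) \<le> t"
proof -
  define u where "u = cdiv t (M + 1)"
  have N: "0 < M + 1" using M_pos by simp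
  have "cdiv (t + (M + 1) * (b i mod a i)) ((M + 1) * a i) = cdiv (b i + u) (a i) - b i div a i"
    if "i < n" for i
  proof -
    have "cdiv (t + (M + 1) * (b i mod a i)) ((M + 1) * a i) = cdiv (u + b i mod a i) (a i)"
      unfolding u_def using a_ge_1[OF that] N by (intro cdiv_scaled) auto
    moreover have "b i + u = u + b i mod a i + (b i div a i) * a i" by simp
    ultimately show ?thesis
      using cdiv_add[of "a i" "u + b i mod a i" "b i div a i"] a_ge_1[OF that] by simp
  qed
  then have "(\<Sum>i<n. M * w i * cdiv (t + (M + 1) * (b i mod a i)) ((M + 1) * a i))
      = (\<Sum>i<n. M * (w i * cdiv (b i + u) (a i) - w i * (b i div a i)))"
    by (intro sum.cong refl) (simp only: lessThan_iff right_diff_distrib mult.assoc)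
  also have "\<dots> = M * (best_value (- u) + u - W)"
    by (simp add: best_value_def W_def sum_subtractf flip: sum_distrib_left)
  \<comment> \<open>Bringing \<open>- u\<close> into the range from 0 to \<open>M - 1\<close> makes
    it an admissible \<open>s\<close>, at the price of the term \<open>cdiv u M * E\<close>.\<close>
  also have "best_value (- u) = best_value ((- u) mod M) - cdiv u M * E"
    using best_value_shift[of "(- u) mod M" "- u div M"]
    by (simp only: mod_div_mult_eq) (simp add: cdiv_def)
  finally have tasks: "(\<Sum>i<n. M * w i * cdiv (t + (M + 1) * (b i mod a i)) ((M + 1) * a i))
      = M * (best_value ((- u) mod M) - cdiv u M * E + u - W)" .
  \<comment> \<open>The extra task contributes \<open>M * E * cdiv u M\<close> and cancels that
    term.\<close>
  have "cdiv t ((M + 1) * M) = cdiv u M"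
    using cdiv_scaled[OF N, of M t 0] M_pos by (simp add: u_def)
  then have "(\<Sum>(c, p, J)\<leftarrow>tasks. c * cdiv (t + J) p) = M * (best_value ((- u) mod M) + u - W)"
    using tasks
    by (simp add: tasks_def o_def interv_sum_list_conv_sum_set_nat atLeast0LessThan algebra_simps)
  then show ?thesis
    unfolding response_times_def ceiling_divide_eq_cdiv u_def by simp
qed

text \<open>Decoding: the load contains \<open>M * u\<close> while \<open>t\<close> is at most
  \<open>(M + 1) * u\<close>. The one \<open>u\<close> left over has to cover
  \<open>M * (best_value s - W) + 1\<close>.\<close>

lemma response_time_ge_best_value:
  assumes "t \<in> response_times tasks 1"
  obtains s where "0 \<le> s" "best_value s \<le> (t - 1) div ((M + 1) * M) + W"
proof -
  define u s where "u = cdiv t (M + 1)" and "s = (- u) mod M"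
  have N: "0 < M + 1" using M_pos by simp
  have "1 + M * (best_value s + u - W) \<le> t"
    using assms unfolding response_times_tasks_iff u_def s_def by blast
  also have "t \<le> (M + 1) * u" unfolding u_def by (rule cdiv_ge[OF N])
  finally have "(best_value s - W) * M \<le> u - 1" by (simp add: algebra_simps)
  then have "best_value s - W \<le> (u - 1) div M"
    using M_pos zdiv_mono1[of "(best_value s - W) * M" "u - 1" M] by simp
  also have "\<dots> = (t - 1) div ((M + 1) * M)"
    unfolding u_def cdiv_minus_one[OF N] using M_pos by (simp add: zdiv_zmult2_eq)
  finally show ?thesis
    using that[of s] M_pos by (simp add: s_def)
qed

lemma response_time_le_mixing_value:
  assumes "v \<in> mixing_values n a b w"
  obtains t where "t \<in> response_times tasks 1" "(t - 1) div ((M + 1) * M) + W \<le> v"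
proof -
  obtain s' where s': "0 \<le> s'" "best_value s' \<le> v"
    using assms by (rule mixing_value_ge_best_value)
  define s where "s = s' mod M"
  have s: "0 \<le> s" "s < M" using M_pos by (simp_all add: s_def)
  \<comment> \<open>Reducing \<open>s'\<close> modulo \<open>M\<close> cannot raise the value,
    because \<open>E\<close> is nonnegative.\<close>
  have "best_value s' = best_value s + (s' div M) * E"
    using best_value_shift[of s "s' div M"] by (simp only: s_def mod_div_mult_eq)
  moreover have "0 \<le> (s' div M) * E"
    using s' M_pos E_nonneg by (simp add: pos_imp_zdiv_nonneg_iff)
  ultimately have v: "best_value s \<le> v" using s' by linarith
  define q where "q = best_value s - W"
  have q: "0 \<le> q" using best_value_ge_W[OF s(1)] by (simp add: q_def)
  \<comment> \<open>\<open>- u\<close> is \<open>s\<close> modulo \<open>M\<close>, and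
    \<open>u - 1 = q * M + (M - s - 1)\<close> lies in block \<open>q\<close>. Among the times that
    round up to \<open>u\<close>, the largest is \<open>(M + 1) * u\<close>.\<close>
  define u where "u = q * M + (M - s)"
  define t where "t = (M + 1) * u"
  have N: "0 < M + 1" using M_pos by simp
  have u: "cdiv t (M + 1) = u" using N by (simp add: t_def cdiv_def minus_mult_right del: mult_minus_right)
  have "- u = s + (- q - 1) * M" by (simp add: u_def algebra_simps)
  then have "(- u) mod M = s" using s by (simp only: mod_mult_self1) simp
  moreover have "0 \<le> t" using q s M_pos by (simp add: t_def u_def)
  \<comment> \<open>After substitution this reads \<open>s + 1 \<le> M\<close>.\<close>
  moreover have "1 + M * (best_value s + u - W) \<le> t"
  proof -
    have "best_value s = q + W" by (simp add: q_def)
    then show ?thesis using s by (simp add: t_def u_def algebra_simps)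
  qed
  ultimately have t: "t \<in> response_times tasks 1"
    unfolding response_times_tasks_iff u by simp
  have "(t - 1) div ((M + 1) * M) = (u - 1) div M"
    using cdiv_minus_one[OF N, of t] u M_pos by (simp add: zdiv_zmult2_eq)
  also have "\<dots> = q"
    by (rule int_div_pos_eq[of _ _ _ "M - s - 1"]) (use s in \<open>simp_all add: u_def\<close>)
  finally have "(t - 1) div ((M + 1) * M) + W \<le> v" using v by (simp add: q_def)
  with t that show ?thesis by blast
qed

text \<open>The block number is monotone in \<open>t\<close>, so encoding any solution bounds its
  value from below by the block of the least response time.\<close>

theorem is_min_mixing_values:
  assumes "response_time_algorithm R T"
  shows "is_min ((answer R tasks 1 - 1) div ((M + 1) * M) + W) (mixing_values n a b w)"
    (is "is_min ?opt _")
proof -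
  have "response_times tasks 1 \<noteq> {}"
    using response_time_le_mixing_value[OF best_value_in_mixing_values[of 0]] by auto
  then have ans: "is_min (answer R tasks 1) (response_times tasks 1)"
    using assms valid_tasks unfolding response_time_algorithm_def by blast
  have lower: "?opt \<le> v" if v: "v \<in> mixing_values n a b w" for v
  proof -
    obtain t where t: "t \<in> response_times tasks 1" "(t - 1) div ((M + 1) * M) + W \<le> v"
      using v by (rule response_time_le_mixing_value)
    then have "answer R tasks 1 \<le> t" using ans by (simp add: is_min_def)
    then have "(answer R tasks 1 - 1) div ((M + 1) * M) \<le> (t - 1) div ((M + 1) * M)"
      using M_pos by (intro zdiv_mono1) auto
    with t show ?thesis by linarith
  qed
  \<comment> \<open>Decoding the answer yields a mixing value not above the candidate; with the
    lower bound the two coincide, so the candidate is attained.\<close>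
  obtain s where s: "0 \<le> s" "best_value s \<le> ?opt"
    using ans response_time_ge_best_value unfolding is_min_def by blast
  have "?opt = best_value s"
    using lower[OF best_value_in_mixing_values[OF s(1)]] s(2) by linarith
  then show ?thesis
    using lower best_value_in_mixing_values[OF s(1)] by (simp add: is_min_def)
qed

end

section \<open>Counting loops and their cost\<close>

definition for_loop :: "com \<Rightarrow> com" where
  "for_loop B = Seq (Assign ''i'' (Const 0))
     (While (Less (Var ''i'') (Var ''n'')) (Seq B (Assign ''i'' (Plus (Var ''i'') (Const 1)))))"

text \<open>Induction from \<open>n\<close> downwards. Every guard test costs 3, including the final
  failing one.\<close>

lemma exec_while_counter:
  assumes step: "\<And>k \<sigma>. k < n \<Longrightarrow> I k \<sigma> \<Longrightarrow> \<exists>m \<sigma>'. exec R P \<sigma> m \<sigma>' \<and> m \<le> c \<and> I (Suc k) \<sigma>'"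
    and counter: "\<And>k \<sigma>. I k \<sigma> \<Longrightarrow> var \<sigma> ''i'' = int k \<and> var \<sigma> ''n'' = int n"
    and "I k \<sigma>" "k \<le> n"
  shows "\<exists>m \<sigma>'. exec R (While (Less (Var ''i'') (Var ''n'')) P) \<sigma> m \<sigma>' \<and>
    m \<le> (n - k) * (c + 3) + 3 \<and> I n \<sigma>'"
  using assms(4,3)
proof (induction k arbitrary: \<sigma> rule: inc_induct)
  case base
  then have "\<not> bval (Less (Var ''i'') (Var ''n'')) \<sigma>" using counter by simp
  from exec.WhileFalse[OF this] base show ?case by (intro exI conjI) auto
next
  case (step k)
  then have b: "bval (Less (Var ''i'') (Var ''n'')) \<sigma>" using counter by simp
  obtain m \<sigma>' where 1: "exec R P \<sigma> m \<sigma>'" "m \<le> c" "I (Suc k) \<sigma>'"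
    using assms(1)[OF step.hyps(2) step.prems] by blast
  obtain m' \<sigma>'' where 2: "exec R (While (Less (Var ''i'') (Var ''n'')) P) \<sigma>' m' \<sigma>''"
      "m' \<le> (n - Suc k) * (c + 3) + 3" "I n \<sigma>''"
    using step.IH[OF 1(3)] by blast
  have "n - k = Suc (n - Suc k)" using step.hyps(2) by simp
  then have "bcost (Less (Var ''i'') (Var ''n'')) + m + m' \<le> (n - k) * (c + 3) + 3"
    using 1(2) 2(2) by simp
  then show ?case using exec.WhileTrue[OF b 1(1) 2(1)] 2(3) by blast
qed

text \<open>A round costs \<open>c\<close> for the body, 4 for the increment and 3 for the guard;
  initialisation and last test cost 5. The last assumption carries the invariant across changes of
  the counter.\<close>

lemma exec_for_loop:
  assumes step: "\<And>k \<sigma>. k < n \<Longrightarrow> var \<sigma> ''i'' = int k \<Longrightarrow> var \<sigma> ''n'' = int n \<Longrightarrow> I k \<sigma> \<Longrightarrow>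
      \<exists>m \<sigma>'. exec R B \<sigma> m \<sigma>' \<and> m \<le> c \<and> var \<sigma>' ''i'' = int k \<and> var \<sigma>' ''n'' = int n \<and> I (Suc k) \<sigma>'"
    and "I 0 \<sigma>" "var \<sigma> ''n'' = int n"
    and counter_irrelevant: "\<And>k \<sigma> x. I k \<sigma> \<Longrightarrow> I k (\<sigma>\<lparr>var := (var \<sigma>)(''i'' := x)\<rparr>)"
  obtains m \<sigma>' where "exec R (for_loop B) \<sigma> m \<sigma>'" "m \<le> n * (c + 7) + 5" "I n \<sigma>'" "var \<sigma>' ''n'' = int n"
proof -
  let ?I = "\<lambda>k \<sigma>. var \<sigma> ''i'' = int k \<and> var \<sigma> ''n'' = int n \<and> I k \<sigma>"
  let ?incr = "Assign ''i'' (Plus (Var ''i'') (Const 1))"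
  have iter: "\<exists>m \<sigma>'. exec R (Seq B ?incr) \<sigma> m \<sigma>' \<and> m \<le> c + 4 \<and> ?I (Suc k) \<sigma>'"
    if k: "k < n" "?I k \<sigma>" for k \<sigma>
  proof -
    obtain m \<sigma>' where B: "exec R B \<sigma> m \<sigma>'" "m \<le> c" "var \<sigma>' ''i'' = int k" "var \<sigma>' ''n'' = int n"
        "I (Suc k) \<sigma>'"
      using step k by blast
    show ?thesis
      by (intro exI conjI, rule exec.Seq[OF B(1) exec.Assign]) (use B counter_irrelevant in auto)
  qed
  have init: "?I 0 (\<sigma>\<lparr>var := (var \<sigma>)(''i'' := 0)\<rparr>)"
    using assms(2,3) counter_irrelevant by simp
  have "\<exists>m \<sigma>'. exec R (While (Less (Var ''i'') (Var ''n'')) (Seq B ?incr))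
      (\<sigma>\<lparr>var := (var \<sigma>)(''i'' := 0)\<rparr>) m \<sigma>' \<and> m \<le> (n - 0) * (c + 4 + 3) + 3 \<and> ?I n \<sigma>'"
    by (rule exec_while_counter[where I = ?I, OF iter _ init]) simp_all
  then obtain m \<sigma>' where
    loop: "exec R (While (Less (Var ''i'') (Var ''n'')) (Seq B ?incr))
      (\<sigma>\<lparr>var := (var \<sigma>)(''i'' := 0)\<rparr>) m \<sigma>'"
    and "m \<le> n * (c + 4 + 3) + 3" "?I n \<sigma>'"
    unfolding diff_zero by blast
  moreover from loop have "exec R (for_loop B) \<sigma> (2 + m) \<sigma>'"
    using exec.Seq[OF exec.Assign[of R "''i''" "Const 0" \<sigma>]] by (simp add: for_loop_def)
  ultimately show ?thesis by (intro that[of "2 + m" \<sigma>']) (simp_all add: algebra_simps)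
qed

section \<open>The program\<close>

definition product_step :: com where
  "product_step = Assign ''M'' (Times (Var ''M'') (Elem ''a'' (Var ''i'')))"

text \<open>The language has no remainder operation, so \<open>b i mod a i\<close> is computed by
  subtracting \<open>f * a i\<close> with the floor quotient \<open>f\<close>. \<open>E\<close>
  starts at \<open>M\<close> and is decreased.\<close>

definition task_step :: com where
  "task_step =
    Seq (Assign ''f'' (Div (Elem ''b'' (Var ''i'')) (Elem ''a'' (Var ''i''))))
   (Seq (Assign ''W'' (Plus (Var ''W'') (Times (Elem ''w'' (Var ''i'')) (Var ''f''))))
   (Seq (Assign ''E'' (Minus (Var ''E'')
          (Times (Elem ''w'' (Var ''i'')) (Div (Var ''M'') (Elem ''a'' (Var ''i''))))))
   (Seq (Store ''c'' (Var ''i'') (Times (Var ''M'') (Elem ''w'' (Var ''i''))))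
   (Seq (Store ''p'' (Var ''i'') (Times (Plus (Var ''M'') (Const 1)) (Elem ''a'' (Var ''i''))))
        (Store ''J'' (Var ''i'') (Times (Plus (Var ''M'') (Const 1))
          (Minus (Elem ''b'' (Var ''i'')) (Times (Var ''f'') (Elem ''a'' (Var ''i''))))))))))"

definition query :: com where
  "query =
    Seq (Store ''c'' (Var ''n'') (Times (Var ''M'') (Var ''E'')))
   (Seq (Store ''p'' (Var ''n'') (Times (Plus (Var ''M'') (Const 1)) (Var ''M'')))
   (Seq (Store ''J'' (Var ''n'') (Const 0))
   (Seq (Call ''t'' ''c'' ''p'' ''J'' (Plus (Var ''n'') (Const 1)) (Const 1))
        (Assign ''opt'' (Plus (Div (Minus (Var ''t'') (Const 1))
          (Times (Plus (Var ''M'') (Const 1)) (Var ''M''))) (Var ''W''))))))"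

definition mixing_program :: com where
  "mixing_program =
    Seq (Assign ''M'' (Const 1))
   (Seq (for_loop product_step)
   (Seq (Assign ''W'' (Const 0))
   (Seq (Assign ''E'' (Var ''M''))
   (Seq (for_loop task_step)
        query))))"

section \<open>Correctness and running time of the program\<close>

context mixing_set
begin

definition input_stored :: "state \<Rightarrow> bool" where
  "input_stored \<sigma> \<longleftrightarrow> (\<forall>j<n. arr \<sigma> ''a'' (int j) = a j \<and> arr \<sigma> ''b'' (int j) = b j \<and> arr \<sigma> ''w'' (int j) = w j)"

definition tasks_stored :: "nat \<Rightarrow> state \<Rightarrow> bool" where
  "tasks_stored k \<sigma> \<longleftrightarrow> var \<sigma> ''M'' = M \<and>
     var \<sigma> ''W'' = (\<Sum>i<k. w i * (b i div a i)) \<and>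
     var \<sigma> ''E'' = M - (\<Sum>i<k. w i * (M div a i)) \<and>
     (\<forall>j<k. arr \<sigma> ''c'' (int j) = M * w j \<and> arr \<sigma> ''p'' (int j) = (M + 1) * a j \<and>
        arr \<sigma> ''J'' (int j) = (M + 1) * (b j mod a j))"

lemma exec_product_step:
  assumes "k < n" "var \<sigma> ''i'' = int k" "var \<sigma> ''n'' = int n"
    "input_stored \<sigma> \<and> var \<sigma> ''M'' = (\<Prod>i<k. a i)"
  shows "\<exists>m \<sigma>'. exec R product_step \<sigma> m \<sigma>' \<and> m \<le> 10 \<and> var \<sigma>' ''i'' = int k \<and> var \<sigma>' ''n'' = int n \<and>
    input_stored \<sigma>' \<and> var \<sigma>' ''M'' = (\<Prod>i<Suc k. a i)"
  unfolding product_step_def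
  by (intro exI conjI, rule exec.Assign) (use assms in \<open>auto simp: input_stored_def\<close>)

lemma exec_task_step:
  assumes "k < n" "var \<sigma> ''i'' = int k" "var \<sigma> ''n'' = int n"
    "input_stored \<sigma> \<and> tasks_stored k \<sigma>"
  shows "\<exists>m \<sigma>'. exec R task_step \<sigma> m \<sigma>' \<and> m \<le> 60 \<and> var \<sigma>' ''i'' = int k \<and> var \<sigma>' ''n'' = int n \<and>
    input_stored \<sigma>' \<and> tasks_stored (Suc k) \<sigma>'"
  unfolding task_step_def
  by (intro exI conjI, (rule exec.Seq exec.Assign exec.Store)+)
    (use assms in \<open>auto simp: input_stored_def tasks_stored_def less_Suc_eq minus_div_mult_eq_mod\<close>)

lemma stored_tasks_eq_tasks:
  assumes "tasks_stored n \<sigma>"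
    and "arr \<sigma> ''c'' (int n) = M * E" "arr \<sigma> ''p'' (int n) = (M + 1) * M" "arr \<sigma> ''J'' (int n) = 0"
  shows "stored_tasks \<sigma> ''c'' ''p'' ''J'' (int n + 1) = tasks"
proof -
  have "[0..int n] = map int [0..<n] @ [int n]"
    by (induction n) (simp_all add: upto_rec2 add.commute)
  then show ?thesis
    using assms by (simp add: stored_tasks_def tasks_def tasks_stored_def)
qed

lemma exec_query:
  assumes "var \<sigma> ''n'' = int n" "tasks_stored n \<sigma>"
  obtains m \<sigma>' where "exec R query \<sigma> m \<sigma>'" "m \<le> cost R tasks 1 + 40"
    "var \<sigma>' ''opt'' = (answer R tasks 1 - 1) div ((M + 1) * M) + W"
proof -
  have vars: "var \<sigma> ''M'' = M" "var \<sigma> ''E'' = E" "var \<sigma> ''W'' = W"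
    using assms(2) by (simp_all add: tasks_stored_def E_def W_def)
  \<comment> \<open>The state at the call: the extra task sits at index \<open>n\<close>, so the
    entries below it stay intact.\<close>
  define \<sigma>' where "\<sigma>' = \<sigma>\<lparr>arr := (arr \<sigma>)(
    ''c'' := (arr \<sigma> ''c'')(int n := M * E),
    ''p'' := (arr \<sigma> ''p'')(int n := (M + 1) * M),
    ''J'' := (arr \<sigma> ''J'')(int n := 0))\<rparr>"
  have "tasks_stored n \<sigma>'" using assms(2) by (simp add: tasks_stored_def \<sigma>'_def)
  then have stored: "stored_tasks \<sigma>' ''c'' ''p'' ''J'' (int n + 1) = tasks"
    by (rule stored_tasks_eq_tasks) (simp_all add: \<sigma>'_def)
  have "\<exists>m \<sigma>'. exec R query \<sigma> m \<sigma>' \<and> m \<le> cost R tasks 1 + 40 \<and>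
      var \<sigma>' ''opt'' = (answer R tasks 1 - 1) div ((M + 1) * M) + W"
    unfolding query_def
    by (intro exI conjI, (rule exec.Seq exec.Assign exec.Store exec.Call[OF refl refl])+)
      (use assms(1) vars stored in \<open>simp_all add: \<sigma>'_def\<close>)
  with that show ?thesis by blast
qed

lemma exec_mixing_program:
  obtains m \<sigma> where "exec R mixing_program (input_state n a b w) m \<sigma>"
    "m \<le> 84 * n + 60 + cost R tasks 1"
    "var \<sigma> ''opt'' = (answer R tasks 1 - 1) div ((M + 1) * M) + W"
proof -
  define \<sigma>0 where "\<sigma>0 = input_state n a b w"
  define \<sigma>1 where "\<sigma>1 = \<sigma>0\<lparr>var := (var \<sigma>0)(''M'' := 1)\<rparr>"
  have 1: "exec R (Assign ''M'' (Const 1)) \<sigma>0 2 \<sigma>1"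
    using exec.Assign[of R "''M''" "Const 1" \<sigma>0] by (simp add: \<sigma>1_def numeral_2_eq_2)
  have "input_stored \<sigma>1 \<and> var \<sigma>1 ''M'' = (\<Prod>i<0. a i)" "var \<sigma>1 ''n'' = int n"
    by (simp_all add: \<sigma>1_def \<sigma>0_def input_state_def input_stored_def Let_def)
  with exec_product_step obtain m2 \<sigma>2 where 2: "exec R (for_loop product_step) \<sigma>1 m2 \<sigma>2"
      "m2 \<le> n * (10 + 7) + 5" "input_stored \<sigma>2 \<and> var \<sigma>2 ''M'' = (\<Prod>i<n. a i)" "var \<sigma>2 ''n'' = int n"
    by (rule exec_for_loop[where I = "\<lambda>k \<sigma>. input_stored \<sigma> \<and> var \<sigma> ''M'' = (\<Prod>i<k. a i)"])
      (simp_all add: input_stored_def)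
  define \<sigma>3 where "\<sigma>3 = \<sigma>2\<lparr>var := (var \<sigma>2)(''W'' := 0)\<rparr>"
  have 3: "exec R (Assign ''W'' (Const 0)) \<sigma>2 2 \<sigma>3"
    using exec.Assign[of R "''W''" "Const 0" \<sigma>2] by (simp add: \<sigma>3_def numeral_2_eq_2)
  define \<sigma>4 where "\<sigma>4 = \<sigma>3\<lparr>var := (var \<sigma>3)(''E'' := var \<sigma>3 ''M'')\<rparr>"
  have 4: "exec R (Assign ''E'' (Var ''M'')) \<sigma>3 2 \<sigma>4"
    using exec.Assign[of R "''E''" "Var ''M''" \<sigma>3] by (simp add: \<sigma>4_def numeral_2_eq_2)
  have "input_stored \<sigma>4 \<and> tasks_stored 0 \<sigma>4" "var \<sigma>4 ''n'' = int n"
    using 2(3,4) by (simp_all add: \<sigma>4_def \<sigma>3_def input_stored_def tasks_stored_def M_def)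
  with exec_task_step obtain m5 \<sigma>5 where 5: "exec R (for_loop task_step) \<sigma>4 m5 \<sigma>5"
      "m5 \<le> n * (60 + 7) + 5" "input_stored \<sigma>5 \<and> tasks_stored n \<sigma>5" "var \<sigma>5 ''n'' = int n"
    by (rule exec_for_loop[where I = "\<lambda>k \<sigma>. input_stored \<sigma> \<and> tasks_stored k \<sigma>"])
      (simp_all add: input_stored_def tasks_stored_def)
  obtain m6 \<sigma>6 where 6: "exec R query \<sigma>5 m6 \<sigma>6" "m6 \<le> cost R tasks 1 + 40"
      "var \<sigma>6 ''opt'' = (answer R tasks 1 - 1) div ((M + 1) * M) + W"
    using exec_query[OF 5(4)] 5(3) by blast
  \<comment> \<open>The loops cost at most \<open>17 * n + 5\<close> and \<open>67 * n + 5\<close>,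
    the assignments 6, and the query 40 besides the subroutine.\<close>
  have "exec R mixing_program \<sigma>0 (2 + (m2 + (2 + (2 + (m5 + m6))))) \<sigma>6"
    unfolding mixing_program_def
    by (intro exec.Seq[OF 1] exec.Seq[OF 2(1)] exec.Seq[OF 3] exec.Seq[OF 4] exec.Seq[OF 5(1)] 6(1))
  then show ?thesis
    unfolding \<sigma>0_def by (rule that) (use 2(2) 5(2) 6(2,3) in simp_all)
qed

text \<open>\<open>145 = 84 + 60 + 1\<close>: the additive 60 is absorbed since \<open>n\<close> is
  at least 1, and the single call costs at most \<open>T\<close>, hence at most \<open>T\<close>
  times a logarithm that is at least 1 for every \<open>x\<close>.\<close>

theorem computes_mixing_min:
  assumes R: "response_time_algorithm R T" and n: "1 \<le> n"
  shows "computes_mixing_min_within mixing_program R n a b w (145 * (real n + T * log 2 (max 2 x)))"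
proof -
  obtain m \<sigma> where exec: "exec R mixing_program (input_state n a b w) m \<sigma>"
    and m: "m \<le> 84 * n + 60 + cost R tasks 1"
    and opt: "var \<sigma> ''opt'' = (answer R tasks 1 - 1) div ((M + 1) * M) + W"
    by (rule exec_mixing_program)
  have "1 \<le> cost R tasks 1 \<and> real (cost R tasks 1) \<le> T"
    using R valid_tasks unfolding response_time_algorithm_def by blast
  then have T: "1 \<le> T" "real (cost R tasks 1) \<le> T" by linarith+
  moreover have "1 \<le> log 2 (max 2 x)" by simp
  ultimately have "T \<le> T * log 2 (max 2 x)" by (simp add: mult_le_cancel_left1)
  moreover have "real m \<le> 84 * real n + 60 + real (cost R tasks 1)"
    using of_nat_mono[OF m, where 'a = real] by simp
  moreover have "1 \<le> real n" using n by simp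
  ultimately have "real m \<le> 145 * (real n + T * log 2 (max 2 x))"
    using T unfolding distrib_left by linarith
  with exec is_min_mixing_values[OF R] opt show ?thesis
    unfolding computes_mixing_min_within_def by metis
qed

end

(* The logarithm is guarded, log b_max being 0, negative or undefined for b_max < 2. *)
theorem theorem24:
  "\<exists>(P :: com) (C :: real).
     \<forall>(R :: subroutine) (T :: real) (n :: nat) (a :: nat \<Rightarrow> int) (b :: nat \<Rightarrow> int) (w :: nat \<Rightarrow> int).
       response_time_algorithm R T \<and> 1 \<le> n \<and>
       (\<forall>i<n. 1 \<le> a i) \<and> (\<forall>i<n. 0 \<le> w i) \<and>
       (\<Sum>i<n. real_of_int (w i) / real_of_int (a i)) \<le> 1 \<longrightarrow>
       computes_mixing_min_within P R n a b w
         (C * (real n + T * log 2 (max 2 (real_of_int (bmax n b)))))"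
proof -
  have "computes_mixing_min_within mixing_program R n a b w
      (145 * (real n + T * log 2 (max 2 (real_of_int (bmax n b)))))"
    if "response_time_algorithm R T" "1 \<le> n" "\<forall>i<n. 1 \<le> a i" "\<forall>i<n. 0 \<le> w i"
      "(\<Sum>i<n. real_of_int (w i) / real_of_int (a i)) \<le> 1" for R T n a b w
  proof -
    interpret mixing_set n a b w by unfold_locales (use that in auto)
    show ?thesis using that by (intro computes_mixing_min)
  qed
  then show ?thesis by blast
qed

end
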